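(* If $g$ is a $(\mathfrak{B},k,\mathcal{G})$-nice Turán-type function, then $g$ is also $(\mathfrak{B},k,\mathcal{G})$-nice with respect to any $(\mathfrak{B},\mathcal{G})$-suitable partition with very abstract chromatic number $k$. If $g$ is a $(\mathfrak{B},k,\mathcal{G})$-supernice Turán-type function, then $g$ is also $(\mathfrak{B},k,\mathcal{G})$-supernice with respect to any $(\mathfrak{B},\mathcal{G})$-suitable partition with very abstract chromatic number $k$. The same holds for the asymptotic versions. In the case $\mathfrak{B}$ is a blowup-decomposition and $g$ is a strongly $(\mathfrak{B},k,\mathcal{G})$-nice Turán-type function, then $g$ is also strongly $(\mathfrak{B},k,\mathcal{G})$-nice with respect to any $(\mathfrak{B},\mathcal{G})$-suitable partition with very abstract chromatic number $k$. The same holds for supernice functions and the asymptotic versions.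
   Context: Let $h$ be a graph parameter and define the Turán-type function $g(n,F)=g_h(n,F)=\max\{h(G): G \text{ is an $n$-vertex $F$-free graph}\}$. Let $\mathfrak{B}$ be a decomposition of all graphs into families $\mathcal{B}$ and $\mathcal{B}_i$ ($i$ ranging over integers, possibly infinite in both directions). Define $g_{\mathcal{B}}(n,F)=\max\{h(G): G \text{ is an $n$-vertex $F$-free graph not in } \mathcal{B}\}$. For a partition $(\mathcal{A},\mathcal{F})$ of all graphs into allowed graphs $\mathcal{A}$ and forbidden graphs $\mathcal{F}$, let $g(n,(\mathcal{A},\mathcal{F}))=\max\{h(G): G \text{ is an $n$-vertex graph in } \mathcal{A}\}$. For every $n$ and $i$ fix an $n$-vertex graph $G_n(i)\in\mathcal{B}_i$, and let $\mathcal{G}$ be the family of these graphs. $g$ is $(\mathfrak{B},k,\mathcal{G})$-nice if for every sufficiently large $n$ and every graph $F\in\mathcal{B}_k$, $g_{\mathcal{B}}(n,F)=h(G_n(k-1))$; it is $(\mathfrak{B},k,\mathcal{G})$-supernice if for every sufficiently large $n$ and every $F\in\mathcal{B}_k$, $g(n,F)=h(G_n(k-1))$. The asymptotic versions replace equality by $=(1+o(1))h(G_n(k-1))$. A partition $(\mathcal{A},\mathcal{F})$ is $(\mathfrak{B},\mathcal{G})$-suitable if for all sufficiently large $n$ one of the following holds: (i) $G_n(k)\in\mathcal{A}$ for every $k$; (ii) there exists an integer $k$ such that each graph of order at least $n$ in each $\mathcal{B}_i$ with $i<k$ is in $\mathcal{A}$, but no $G\in\mathcal{A}$ contains $G_n(k)$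 as a subgraph. Its very abstract chromatic number is $\infty$ in case (i) and $k$ in case (ii). $g$ is $(\mathfrak{B},k,\mathcal{G})$-nice with respect to $(\mathcal{A},\mathcal{F})$ if $g(n,(\mathcal{A}\setminus\mathcal{B},\mathcal{F}\cup\mathcal{B}))=h(G_n(k-1))$, and $(\mathfrak{B},k,\mathcal{G})$-supernice with respect to $(\mathcal{A},\mathcal{F})$ if $g(n,(\mathcal{A},\mathcal{F}))=h(G_n(k-1))$; asymptotic versions replace equality by $(1+o(1))$ asymptotic equality. A blowup of a graph $G$ replaces each vertex $v$ by a set $S(v)$ and each edge $uv$ by a complete bipartite graph between $S(u)$ and $S(v)$; it is balanced if every $S(v)$ has size $t$ or $t+1$ for some $t$. $\mathfrak{B}$ is a blowup-decomposition if there are graphs $B_i$ such that $\mathcal{B}_i$ is the family of graphs that are subgraphs of a blowup of $B_i$ but not subgraphs of any blowup of any $B_j$ with $j<i$. In that case, "strongly" nice/supernice (also with respect to a partition, and in asymptotic versions) means the corresponding property holds with $G_n(k)$ (resp. $G_n(k-1)$) being a balanced blowup of $B_k$ (resp. $B_{k-1}$). *)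

theory Defs
  imports
    "Graph_Theory.Graph_Theory"
    "HOL-Library.Disjoint_Sets"
    "HOL-Library.Extended"
    "HOL-Library.Landau_Symbols"
begin

text \<open>
  Finite simple graphs are the symmetric loop-free digraphs (\<^locale>\<open>pair_graph\<close>) on finite sets of
  natural numbers: every finite graph has an isomorphic copy of this form. Families of graphs are
  closed under isomorphism and graph parameters are isomorphism invariant.
\<close>

type_synonym fgraph = "nat pair_pre_digraph"
type_synonym family = "fgraph set"

definition graphs :: family where
  "graphs = {G. pair_graph G}"

definition order :: "fgraph \<Rightarrow> nat" where
  "order G = card (pverts G)"

definition iso :: "fgraph \<Rightarrow> fgraph \<Rightarrow> bool" where
  "iso G H \<longleftrightarrow> digraph_iso (with_proj G) (with_proj H)"

definition graph_family :: "family \<Rightarrow> bool" where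
  "graph_family \<C> \<longleftrightarrow> \<C> \<subseteq> graphs \<and> (\<forall>G\<in>\<C>. \<forall>H\<in>graphs. iso G H \<longrightarrow> H \<in> \<C>)"

definition graph_parameter :: "(fgraph \<Rightarrow> real) \<Rightarrow> bool" where
  "graph_parameter h \<longleftrightarrow> (\<forall>G\<in>graphs. \<forall>H\<in>graphs. iso G H \<longrightarrow> h G = h H)"

text \<open>Containment is as a not necessarily induced subgraph, up to isomorphism.\<close>

definition contains :: "fgraph \<Rightarrow> fgraph \<Rightarrow> bool" where
  "contains G F \<longleftrightarrow>
    (\<exists>F'\<in>graphs. iso F F' \<and> subgraph (with_proj F') (with_proj G))"

subsection \<open>Tur\'an-type functions\<close>

text \<open>
  For each order \<^term>\<open>n\<close> a graph parameter takes only finitely many values, so these maxima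
  exist as soon as some graph satisfies the constraints.
\<close>

definition turan :: "(fgraph \<Rightarrow> real) \<Rightarrow> nat \<Rightarrow> fgraph \<Rightarrow> real" where
  "turan h n F = Max (h ` {G \<in> graphs. order G = n \<and> \<not> contains G F})"

definition turan_outside :: "(fgraph \<Rightarrow> real) \<Rightarrow> family \<Rightarrow> nat \<Rightarrow> fgraph \<Rightarrow> real" where
  "turan_outside h \<B> n F =
    Max (h ` {G \<in> graphs. order G = n \<and> \<not> contains G F \<and> G \<notin> \<B>})"

type_synonym graph_partition = "family \<times> family"

fun turan_partition :: "(fgraph \<Rightarrow> real) \<Rightarrow> nat \<Rightarrow> graph_partition \<Rightarrow> real" where
  "turan_partition h n (\<A>, \<F>) = Max (h ` {G \<in> \<A>. order G = n})"

fun is_partition :: "graph_partition \<Rightarrow> bool" where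
  "is_partition (\<A>, \<F>) \<longleftrightarrow>
    graph_family \<A> \<and> graph_family \<F> \<and> \<A> \<inter> \<F> = {} \<and> \<A> \<union> \<F> = graphs"

subsection \<open>Decompositions\<close>

text \<open>The index set may be any set of integers, bounded or unbounded in either direction.\<close>

record decomp =
  indices :: "int set"
  part :: "int \<Rightarrow> family"
  rest :: family

definition is_decomposition :: "decomp \<Rightarrow> bool" where
  "is_decomposition D \<longleftrightarrow>
    graph_family (rest D) \<and>
    (\<forall>i\<in>indices D. graph_family (part D i)) \<and>
    (\<forall>i\<in>indices D. part D i \<inter> rest D = {}) \<and>
    disjoint_family_on (part D) (indices D) \<and>
    rest D \<union> (\<Union>i\<in>indices D. part D i) = graphs"

text \<open>
  Distinct families cannot both contain a one-vertex graph, so an \<open>n\<close>-vertex member of the family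
  with index \<open>i\<close> can only be demanded for all \<open>n\<close> that are large in terms of \<open>i\<close>. The graph
  \<open>\<G> n i\<close> is meaningful exactly when such a member exists.
\<close>

definition occurs :: "decomp \<Rightarrow> nat \<Rightarrow> int \<Rightarrow> bool" where
  "occurs D n i \<longleftrightarrow> i \<in> indices D \<and> (\<exists>G\<in>part D i. order G = n)"

definition is_selection :: "decomp \<Rightarrow> (nat \<Rightarrow> int \<Rightarrow> fgraph) \<Rightarrow> bool" where
  "is_selection D \<G> \<longleftrightarrow>
    (\<forall>i\<in>indices D. \<forall>\<^sub>F n in sequentially. occurs D n i) \<and>
    (\<forall>n i. occurs D n i \<longrightarrow> \<G> n i \<in> part D i \<and> order (\<G> n i) = n)"

subsection \<open>Nice and supernice functions\<close>

text \<open>How large \<open>n\<close> has to be may depend on the forbidden graph \<open>F\<close>.\<close>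

definition nice :: "(fgraph \<Rightarrow> real) \<Rightarrow> decomp \<Rightarrow> int \<Rightarrow> (nat \<Rightarrow> int \<Rightarrow> fgraph) \<Rightarrow> bool" where
  "nice h D k \<G> \<longleftrightarrow> k \<in> indices D \<and> k - 1 \<in> indices D \<and>
    (\<forall>F\<in>part D k. \<forall>\<^sub>F n in sequentially. turan_outside h (rest D) n F = h (\<G> n (k - 1)))"

definition supernice :: "(fgraph \<Rightarrow> real) \<Rightarrow> decomp \<Rightarrow> int \<Rightarrow> (nat \<Rightarrow> int \<Rightarrow> fgraph) \<Rightarrow> bool" where
  "supernice h D k \<G> \<longleftrightarrow> k \<in> indices D \<and> k - 1 \<in> indices D \<and>
    (\<forall>F\<in>part D k. \<forall>\<^sub>F n in sequentially. turan h n F = h (\<G> n (k - 1)))"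

definition asymp_nice :: "(fgraph \<Rightarrow> real) \<Rightarrow> decomp \<Rightarrow> int \<Rightarrow> (nat \<Rightarrow> int \<Rightarrow> fgraph) \<Rightarrow> bool" where
  "asymp_nice h D k \<G> \<longleftrightarrow> k \<in> indices D \<and> k - 1 \<in> indices D \<and>
    (\<forall>F\<in>part D k. (\<lambda>n. turan_outside h (rest D) n F) \<sim>[sequentially] (\<lambda>n. h (\<G> n (k - 1))))"

definition asymp_supernice :: "(fgraph \<Rightarrow> real) \<Rightarrow> decomp \<Rightarrow> int \<Rightarrow> (nat \<Rightarrow> int \<Rightarrow> fgraph) \<Rightarrow> bool" where
  "asymp_supernice h D k \<G> \<longleftrightarrow> k \<in> indices D \<and> k - 1 \<in> indices D \<and>
    (\<forall>F\<in>part D k. (\<lambda>n. turan h n F) \<sim>[sequentially] (\<lambda>n. h (\<G> n (k - 1))))"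

subsection \<open>Suitable partitions and the very abstract chromatic number\<close>

fun all_allowed_at :: "decomp \<Rightarrow> (nat \<Rightarrow> int \<Rightarrow> fgraph) \<Rightarrow> graph_partition \<Rightarrow> nat \<Rightarrow> bool" where
  "all_allowed_at D \<G> (\<A>, \<F>) n \<longleftrightarrow> (\<forall>i. occurs D n i \<longrightarrow> \<G> n i \<in> \<A>)"

fun threshold_at :: "decomp \<Rightarrow> (nat \<Rightarrow> int \<Rightarrow> fgraph) \<Rightarrow> graph_partition \<Rightarrow> nat \<Rightarrow> int \<Rightarrow> bool" where
  "threshold_at D \<G> (\<A>, \<F>) n k \<longleftrightarrow>
    occurs D n k \<and>
    (\<forall>i\<in>indices D. i < k \<longrightarrow> (\<forall>G\<in>part D i. n \<le> order G \<longrightarrow> G \<in> \<A>)) \<and>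
    (\<forall>G\<in>\<A>. \<not> contains G (\<G> n k))"

definition suitable :: "decomp \<Rightarrow> (nat \<Rightarrow> int \<Rightarrow> fgraph) \<Rightarrow> graph_partition \<Rightarrow> bool" where
  "suitable D \<G> P \<longleftrightarrow> is_partition P \<and>
    (\<forall>\<^sub>F n in sequentially. all_allowed_at D \<G> P n \<or> (\<exists>k. threshold_at D \<G> P n k))"

definition has_very_abstract_chromatic_number ::
    "decomp \<Rightarrow> (nat \<Rightarrow> int \<Rightarrow> fgraph) \<Rightarrow> graph_partition \<Rightarrow> int extended \<Rightarrow> bool" where
  "has_very_abstract_chromatic_number D \<G> P c \<longleftrightarrow>
    (case c of
       Fin k \<Rightarrow> \<forall>\<^sub>F n in sequentially. threshold_at D \<G> P n k
     | Pinf \<Rightarrow> \<forall>\<^sub>F n in sequentially. all_allowed_at D \<G> P n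
     | Minf \<Rightarrow> False)"

subsection \<open>Niceness with respect to a partition\<close>

fun forbid :: "graph_partition \<Rightarrow> family \<Rightarrow> graph_partition" where
  "forbid (\<A>, \<F>) \<B> = (\<A> - \<B>, \<F> \<union> \<B>)"

definition nice_wrt ::
    "(fgraph \<Rightarrow> real) \<Rightarrow> decomp \<Rightarrow> int \<Rightarrow> (nat \<Rightarrow> int \<Rightarrow> fgraph) \<Rightarrow> graph_partition \<Rightarrow> bool" where
  "nice_wrt h D k \<G> P \<longleftrightarrow> k \<in> indices D \<and> k - 1 \<in> indices D \<and>
    (\<forall>\<^sub>F n in sequentially. turan_partition h n (forbid P (rest D)) = h (\<G> n (k - 1)))"

definition supernice_wrt ::
    "(fgraph \<Rightarrow> real) \<Rightarrow> decomp \<Rightarrow> int \<Rightarrow> (nat \<Rightarrow> int \<Rightarrow> fgraph) \<Rightarrow> graph_partition \<Rightarrow> bool" where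
  "supernice_wrt h D k \<G> P \<longleftrightarrow> k \<in> indices D \<and> k - 1 \<in> indices D \<and>
    (\<forall>\<^sub>F n in sequentially. turan_partition h n P = h (\<G> n (k - 1)))"

definition asymp_nice_wrt ::
    "(fgraph \<Rightarrow> real) \<Rightarrow> decomp \<Rightarrow> int \<Rightarrow> (nat \<Rightarrow> int \<Rightarrow> fgraph) \<Rightarrow> graph_partition \<Rightarrow> bool" where
  "asymp_nice_wrt h D k \<G> P \<longleftrightarrow> k \<in> indices D \<and> k - 1 \<in> indices D \<and>
    (\<lambda>n. turan_partition h n (forbid P (rest D))) \<sim>[sequentially] (\<lambda>n. h (\<G> n (k - 1)))"

definition asymp_supernice_wrt ::
    "(fgraph \<Rightarrow> real) \<Rightarrow> decomp \<Rightarrow> int \<Rightarrow> (nat \<Rightarrow> int \<Rightarrow> fgraph) \<Rightarrow> graph_partition \<Rightarrow> bool" where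
  "asymp_supernice_wrt h D k \<G> P \<longleftrightarrow> k \<in> indices D \<and> k - 1 \<in> indices D \<and>
    (\<lambda>n. turan_partition h n P) \<sim>[sequentially] (\<lambda>n. h (\<G> n (k - 1)))"

subsection \<open>Blowups\<close>

definition blowup :: "fgraph \<Rightarrow> (nat \<Rightarrow> nat set) \<Rightarrow> fgraph" where
  "blowup G S =
    \<lparr> pverts = (\<Union>v\<in>pverts G. S v), parcs = (\<Union>(u, v)\<in>parcs G. S u \<times> S v) \<rparr>"

definition blowup_sets :: "fgraph \<Rightarrow> (nat \<Rightarrow> nat set) \<Rightarrow> bool" where
  "blowup_sets G S \<longleftrightarrow> (\<forall>v\<in>pverts G. finite (S v)) \<and> disjoint_family_on S (pverts G)"

definition is_blowup :: "fgraph \<Rightarrow> fgraph \<Rightarrow> bool" where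
  "is_blowup H G \<longleftrightarrow> (\<exists>S. blowup_sets G S \<and> H = blowup G S)"

definition is_balanced_blowup :: "fgraph \<Rightarrow> fgraph \<Rightarrow> bool" where
  "is_balanced_blowup H G \<longleftrightarrow>
    (\<exists>S t. blowup_sets G S \<and> (\<forall>v\<in>pverts G. card (S v) \<in> {t, t + 1}) \<and> H = blowup G S)"

definition in_some_blowup :: "fgraph \<Rightarrow> fgraph \<Rightarrow> bool" where
  "in_some_blowup G B \<longleftrightarrow> (\<exists>H. is_blowup H B \<and> contains H G)"

definition is_blowup_decomposition :: "decomp \<Rightarrow> (int \<Rightarrow> fgraph) \<Rightarrow> bool" where
  "is_blowup_decomposition D B \<longleftrightarrow>
    (\<forall>i\<in>indices D. B i \<in> graphs \<and>
       part D i = {G \<in> graphs. in_some_blowup G (B i) \<and>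
                     \<not> (\<exists>j\<in>indices D. j < i \<and> in_some_blowup G (B j))})"

text \<open>
  The strong properties: for large \<open>n\<close>, the selected graphs with indices \<open>k\<close> and \<open>k - 1\<close> are balanced
  blowups of the graphs \<open>B k\<close> and \<open>B (k - 1)\<close> defining the decomposition.
\<close>

definition balanced_selection :: "(int \<Rightarrow> fgraph) \<Rightarrow> int \<Rightarrow> (nat \<Rightarrow> int \<Rightarrow> fgraph) \<Rightarrow> bool" where
  "balanced_selection B k \<G> \<longleftrightarrow>
    (\<forall>\<^sub>F n in sequentially.
       is_balanced_blowup (\<G> n k) (B k) \<and> is_balanced_blowup (\<G> n (k - 1)) (B (k - 1)))"

definition strongly_nice ::
    "(int \<Rightarrow> fgraph) \<Rightarrow> (fgraph \<Rightarrow> real) \<Rightarrow> decomp \<Rightarrow> int \<Rightarrow> (nat \<Rightarrow> int \<Rightarrow> fgraph) \<Rightarrow> bool" where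
  "strongly_nice B h D k \<G> \<longleftrightarrow> nice h D k \<G> \<and> balanced_selection B k \<G>"

definition strongly_supernice ::
    "(int \<Rightarrow> fgraph) \<Rightarrow> (fgraph \<Rightarrow> real) \<Rightarrow> decomp \<Rightarrow> int \<Rightarrow> (nat \<Rightarrow> int \<Rightarrow> fgraph) \<Rightarrow> bool" where
  "strongly_supernice B h D k \<G> \<longleftrightarrow> supernice h D k \<G> \<and> balanced_selection B k \<G>"

definition strongly_asymp_nice ::
    "(int \<Rightarrow> fgraph) \<Rightarrow> (fgraph \<Rightarrow> real) \<Rightarrow> decomp \<Rightarrow> int \<Rightarrow> (nat \<Rightarrow> int \<Rightarrow> fgraph) \<Rightarrow> bool" where
  "strongly_asymp_nice B h D k \<G> \<longleftrightarrow> asymp_nice h D k \<G> \<and> balanced_selection B k \<G>"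

definition strongly_asymp_supernice ::
    "(int \<Rightarrow> fgraph) \<Rightarrow> (fgraph \<Rightarrow> real) \<Rightarrow> decomp \<Rightarrow> int \<Rightarrow> (nat \<Rightarrow> int \<Rightarrow> fgraph) \<Rightarrow> bool" where
  "strongly_asymp_supernice B h D k \<G> \<longleftrightarrow> asymp_supernice h D k \<G> \<and> balanced_selection B k \<G>"

definition strongly_nice_wrt ::
    "(int \<Rightarrow> fgraph) \<Rightarrow> (fgraph \<Rightarrow> real) \<Rightarrow> decomp \<Rightarrow> int \<Rightarrow> (nat \<Rightarrow> int \<Rightarrow> fgraph) \<Rightarrow> graph_partition \<Rightarrow> bool" where
  "strongly_nice_wrt B h D k \<G> P \<longleftrightarrow> nice_wrt h D k \<G> P \<and> balanced_selection B k \<G>"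

definition strongly_supernice_wrt ::
    "(int \<Rightarrow> fgraph) \<Rightarrow> (fgraph \<Rightarrow> real) \<Rightarrow> decomp \<Rightarrow> int \<Rightarrow> (nat \<Rightarrow> int \<Rightarrow> fgraph) \<Rightarrow> graph_partition \<Rightarrow> bool" where
  "strongly_supernice_wrt B h D k \<G> P \<longleftrightarrow> supernice_wrt h D k \<G> P \<and> balanced_selection B k \<G>"

definition strongly_asymp_nice_wrt ::
    "(int \<Rightarrow> fgraph) \<Rightarrow> (fgraph \<Rightarrow> real) \<Rightarrow> decomp \<Rightarrow> int \<Rightarrow> (nat \<Rightarrow> int \<Rightarrow> fgraph) \<Rightarrow> graph_partition \<Rightarrow> bool" where
  "strongly_asymp_nice_wrt B h D k \<G> P \<longleftrightarrow> asymp_nice_wrt h D k \<G> P \<and> balanced_selection B k \<G>"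

definition strongly_asymp_supernice_wrt ::
    "(int \<Rightarrow> fgraph) \<Rightarrow> (fgraph \<Rightarrow> real) \<Rightarrow> decomp \<Rightarrow> int \<Rightarrow> (nat \<Rightarrow> int \<Rightarrow> fgraph) \<Rightarrow> graph_partition \<Rightarrow> bool" where
  "strongly_asymp_supernice_wrt B h D k \<G> P \<longleftrightarrow> asymp_supernice_wrt h D k \<G> P \<and> balanced_selection B k \<G>"

end

theory Submission
  imports Defs
begin

text \<open>
  Fix one large \<open>m\<close> for which the threshold condition holds and put \<open>F = \<G> m k\<close>. No allowed graph
  contains \<open>F\<close>, so \<open>g(n, F)\<close> bounds the maximum over the allowed graphs from above for every \<open>n\<close>.
  For large \<open>n\<close> the graph \<open>\<G> n (k - 1)\<close> is itself allowed, which gives the lower bound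
  \<open>h (\<G> n (k - 1))\<close>. Niceness says that the two bounds agree (asymptotically).
\<close>

text \<open>Relabel the vertices along a bijection onto an initial segment. There are infinitely
  many graphs of a given order on sets of naturals; this supplies a representative of each
  isomorphism class on one fixed vertex set.\<close>

lemma ex_iso_on_initial_segment:
  assumes "G \<in> graphs"
  obtains H where "H \<in> graphs" "iso G H" "pverts H = {..<order G}"
proof -
  interpret pair_graph G
    using assms by (simp add: graphs_def)
  obtain f where "bij_betw f (pverts G) {0..<order G}"
    using ex_bij_betw_finite_nat[OF pair_finite_verts] by (auto simp: order_def)
  then have f: "bij_betw f (pverts G) {..<order G}"
    by (simp add: lessThan_atLeast0)
  then have inj: "inj_on f (pverts G)"
    by (simp add: bij_betw_def)
  \<comment> \<open>Arcs are pairs of vertices, so the relabelling \<open>f\<close> has to move them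
    by \<open>map_prod f f\<close>; head and tail remain the projections, which makes the image
    again of the form \<open>with_proj H\<close>.\<close>
  define \<phi> where "\<phi> = \<lparr>iso_verts = f, iso_arcs = map_prod f f, iso_head = snd, iso_tail = fst\<rparr>"
  define H where "H = \<lparr>pverts = f ` pverts G, parcs = map_prod f f ` parcs G\<rparr>"
  have sub: "parcs G \<subseteq> pverts G \<times> pverts G"
    using in_arcsD1 in_arcsD2 by auto
  have "inj_on (map_prod f f) (parcs G)"
    using map_prod_inj_on[OF inj inj] sub by (rule inj_on_subset)
  then have \<phi>: "digraph_isomorphism \<phi>"
    using inj by (auto simp: digraph_isomorphism_def \<phi>_def intro: wf_digraph_axioms)
  have H: "with_proj H = app_iso \<phi> (with_proj G)"
    by (simp add: with_proj_def app_iso_def H_def \<phi>_def)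
  have "pair_graph H"
  proof unfold_locales
    show "fst e \<in> pverts H" "snd e \<in> pverts H" if "e \<in> parcs H" for e
      using that by (auto simp: H_def dest: in_arcsD1 in_arcsD2)
    show "finite (pverts H)" "finite (parcs H)"
      using pair_finite_verts pair_finite_arcs by (simp_all add: H_def)
    show "fst e \<noteq> snd e" if "e \<in> parcs H" for e
      using that inj pair_no_loops by (force simp: H_def inj_on_eq_iff in_arcsD1 in_arcsD2)
    show "symmetric H"
      using pair_sym_arcs by (force simp: symmetric_def sym_def H_def)
  qed
  moreover have "iso G H"
    using \<phi> H by (auto simp: iso_def digraph_iso_def)
  moreover have "pverts H = {..<order G}"
    using f by (simp add: H_def bij_betw_def)
  ultimately show ?thesis
    using that by (simp add: graphs_def)
qed

lemma finite_graphs_on: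
  assumes "finite V"
  shows "finite {G \<in> graphs. pverts G = V}"
proof (rule finite_subset)
  show "{G \<in> graphs. pverts G = V} \<subseteq> (\<lambda>E. \<lparr>pverts = V, parcs = E\<rparr>) ` Pow (V \<times> V)"
  proof
    fix G assume G: "G \<in> {G \<in> graphs. pverts G = V}"
    then interpret pair_graph G
      by (simp add: graphs_def)
    have "parcs G \<subseteq> V \<times> V"
      using G in_arcsD1 in_arcsD2 by auto
    moreover have "G = \<lparr>pverts = V, parcs = parcs G\<rparr>"
      using G by simp
    ultimately show "G \<in> (\<lambda>E. \<lparr>pverts = V, parcs = E\<rparr>) ` Pow (V \<times> V)"
      by blast
  qed
qed (use assms in simp)

text \<open>By isomorphism invariance, all values at order \<open>n\<close> are already taken on the
  finitely many graphs with vertex set \<open>{..<n}\<close>. This is what gives meaning to every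
  \<open>Max\<close> below, as \<open>Max\<close> of an infinite set is unspecified.\<close>

lemma finite_graph_parameter_values:
  assumes "graph_parameter h"
  shows "finite (h ` {G \<in> graphs. order G = n})"
proof (rule finite_subset)
  show "h ` {G \<in> graphs. order G = n} \<subseteq> h ` {G \<in> graphs. pverts G = {..<n}}"
  proof (rule image_subsetI)
    fix G assume G: "G \<in> {G \<in> graphs. order G = n}"
    then obtain H where "H \<in> graphs" "iso G H" "pverts H = {..<n}"
      by (auto elim: ex_iso_on_initial_segment)
    moreover from this have "h G = h H"
      using G assms by (auto simp: graph_parameter_def)
    ultimately show "h G \<in> h ` {G \<in> graphs. pverts G = {..<n}}"
      by blast
  qed
qed (simp add: finite_graphs_on)

text \<open>The fixed order \<open>n\<close> supplies finiteness, and nonemptiness of the smaller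
  class rules out the unspecified value \<open>Max {}\<close>.\<close>

lemma Max_graph_parameter_mono:
  assumes "graph_parameter h" "\<C> \<subseteq> \<C>'" "\<C>' \<subseteq> {G \<in> graphs. order G = n}" "\<C> \<noteq> {}"
  shows "Max (h ` \<C>) \<le> Max (h ` \<C>')"
proof (rule Max_mono)
  show "finite (h ` \<C>')"
    using assms(3) by (intro finite_subset[OF _ finite_graph_parameter_values[OF assms(1)]] image_mono)
qed (use assms in auto)

lemma graph_parameter_le_Max:
  assumes "graph_parameter h" "\<C> \<subseteq> {G \<in> graphs. order G = n}" "G \<in> \<C>"
  shows "h G \<le> Max (h ` \<C>)"
proof (rule Max_ge)
  show "finite (h ` \<C>)"
    using assms(2) by (intro finite_subset[OF _ finite_graph_parameter_values[OF assms(1)]] image_mono)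
qed (use assms in auto)

text \<open>\<open>F\<close> has to be chosen before \<open>n\<close>, because the point from which
  niceness applies depends on \<open>F\<close>. The bounds do not mention niceness, so they serve
  the exact and the asymptotic versions alike.\<close>

lemma turan_partition_bounds:
  assumes h: "graph_parameter h" and D: "is_decomposition D" and sel: "is_selection D \<G>"
    and P: "suitable D \<G> P" "has_very_abstract_chromatic_number D \<G> P (Fin k)"
    and k: "k - 1 \<in> indices D"
  obtains F where "F \<in> part D k"
    "\<forall>\<^sub>F n in sequentially. h (\<G> n (k - 1)) \<le> turan_partition h n P
      \<and> turan_partition h n P \<le> turan h n F"
    "\<forall>\<^sub>F n in sequentially. h (\<G> n (k - 1)) \<le> turan_partition h n (forbid P (rest D))
      \<and> turan_partition h n (forbid P (rest D)) \<le> turan_outside h (rest D) n F"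
proof -
  obtain \<A> \<F> where P_eq: "P = (\<A>, \<F>)"
    by (cases P)
  have \<A>: "\<A> \<subseteq> graphs"
    using P(1) by (auto simp: suitable_def P_eq)
  have "\<forall>\<^sub>F n in sequentially. threshold_at D \<G> P n k"
    using P(2) by (simp add: has_very_abstract_chromatic_number_def)
  \<comment> \<open>This \<open>m\<close> has two roles: \<open>\<G> m k\<close> becomes the
    forbidden graph, and \<open>m\<close> is the order from which all members of
    \<open>part D (k - 1)\<close> are allowed.\<close>
  then obtain m where "threshold_at D \<G> P m k"
    by (auto simp: eventually_sequentially)
  then have m: "occurs D m k" "\<And>G. G \<in> part D (k - 1) \<Longrightarrow> m \<le> order G \<Longrightarrow> G \<in> \<A>"
      "\<And>G. G \<in> \<A> \<Longrightarrow> \<not> contains G (\<G> m k)"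
    using k by (auto simp: P_eq)
  have "\<forall>\<^sub>F n in sequentially. occurs D n (k - 1)"
    using sel k by (auto simp: is_selection_def)
  \<comment> \<open>Membership in \<open>\<A> - rest D\<close> lets the same graph witness the lower
    bound for \<open>P\<close> and for \<open>forbid P (rest D)\<close>.\<close>
  then have allowed: "\<forall>\<^sub>F n in sequentially. \<G> n (k - 1) \<in> \<A> - rest D \<and> order (\<G> n (k - 1)) = n"
    using eventually_ge_at_top[of m]
  proof eventually_elim
    case (elim n)
    then have "\<G> n (k - 1) \<in> part D (k - 1)" "order (\<G> n (k - 1)) = n"
      using sel by (auto simp: is_selection_def)
    moreover from this have "\<G> n (k - 1) \<notin> rest D"
      using D k by (auto simp: is_decomposition_def)
    ultimately show ?case
      using m(2) elim by auto
  qed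
  show thesis
  proof (rule that)
    show "\<G> m k \<in> part D k"
      using sel m(1) by (auto simp: is_selection_def)
    show "\<forall>\<^sub>F n in sequentially. h (\<G> n (k - 1)) \<le> turan_partition h n P
        \<and> turan_partition h n P \<le> turan h n (\<G> m k)"
      using allowed
    proof eventually_elim
      case (elim n)
      \<comment> \<open>The graph \<open>\<G> n (k - 1)\<close> gives the lower bound and also makes
        the class of allowed graphs of order \<open>n\<close> nonempty, as monotonicity of the
        maximum demands.\<close>
      then show ?case
        using \<A> m(3) unfolding P_eq turan_partition.simps turan_def
        by (intro conjI graph_parameter_le_Max[OF h, of _ n] Max_graph_parameter_mono[OF h, of _ _ n]) auto
    qed
    show "\<forall>\<^sub>F n in sequentially. h (\<G> n (k - 1)) \<le> turan_partition h n (forbid P (rest D))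
        \<and> turan_partition h n (forbid P (rest D)) \<le> turan_outside h (rest D) n (\<G> m k)"
      using allowed
    proof eventually_elim
      case (elim n)
      then show ?case
        using \<A> m(3) unfolding P_eq forbid.simps turan_partition.simps turan_outside_def
        by (intro conjI graph_parameter_le_Max[OF h, of _ n] Max_graph_parameter_mono[OF h, of _ _ n]) auto
    qed
  qed
qed

lemma eventually_eq_sandwich:
  fixes f g u :: "'a \<Rightarrow> 'b :: order"
  assumes "\<forall>\<^sub>F x in L. f x \<le> g x \<and> g x \<le> u x" "\<forall>\<^sub>F x in L. u x = f x"
  shows "\<forall>\<^sub>F x in L. g x = f x"
  using assms by eventually_elim auto

lemma asymp_equiv_sandwich_le:
  fixes f g u :: "'a \<Rightarrow> real"
  assumes "\<forall>\<^sub>F x in L. f x \<le> g x \<and> g x \<le> u x" "u \<sim>[L] f"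
  shows "g \<sim>[L] f"
  \<comment> \<open>Here \<open>f\<close> is both the lower bound and the function compared with, so
    one of the two required equivalences is reflexivity.\<close>
  using assms by (intro asymp_equiv_sandwich_real[of f L f u g]) auto

lemma nice_wrt_suitable_partition:
  assumes h: "graph_parameter h" and D: "is_decomposition D" and sel: "is_selection D \<G>"
    and P: "suitable D \<G> P" "has_very_abstract_chromatic_number D \<G> P (Fin k)"
  shows "nice h D k \<G> \<Longrightarrow> nice_wrt h D k \<G> P"
    and "supernice h D k \<G> \<Longrightarrow> supernice_wrt h D k \<G> P"
    and "asymp_nice h D k \<G> \<Longrightarrow> asymp_nice_wrt h D k \<G> P"
    and "asymp_supernice h D k \<G> \<Longrightarrow> asymp_supernice_wrt h D k \<G> P"
proof -
  note bounds = turan_partition_bounds[OF h D sel P]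
  show "nice_wrt h D k \<G> P" if "nice h D k \<G>"
  proof -
    have k: "k \<in> indices D" "k - 1 \<in> indices D"
      using that by (simp_all add: nice_def)
    note eq = that[unfolded nice_def, THEN conjunct2, THEN conjunct2, THEN bspec]
    show ?thesis
      unfolding nice_wrt_def
      \<comment> \<open>The goal fixes the middle function, so \<open>erule\<close> selects the
        matching one of the two sandwiches; its upper function is the one for the obtained
        \<open>F\<close>, to which \<open>eq\<close> applies.\<close>
      by (intro conjI k, rule bounds[OF k(2)], erule eventually_eq_sandwich, erule eq)
  qed
  show "supernice_wrt h D k \<G> P" if "supernice h D k \<G>"
  proof -
    have k: "k \<in> indices D" "k - 1 \<in> indices D"
      using that by (simp_all add: supernice_def)
    note eq = that[unfolded supernice_def, THEN conjunct2, THEN conjunct2, THEN bspec]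
    show ?thesis
      unfolding supernice_wrt_def
      by (intro conjI k, rule bounds[OF k(2)], erule eventually_eq_sandwich, erule eq)
  qed
  show "asymp_nice_wrt h D k \<G> P" if "asymp_nice h D k \<G>"
  proof -
    have k: "k \<in> indices D" "k - 1 \<in> indices D"
      using that by (simp_all add: asymp_nice_def)
    note eq = that[unfolded asymp_nice_def, THEN conjunct2, THEN conjunct2, THEN bspec]
    show ?thesis
      unfolding asymp_nice_wrt_def
      by (intro conjI k, rule bounds[OF k(2)], erule asymp_equiv_sandwich_le, erule eq)
  qed
  show "asymp_supernice_wrt h D k \<G> P" if "asymp_supernice h D k \<G>"
  proof -
    have k: "k \<in> indices D" "k - 1 \<in> indices D"
      using that by (simp_all add: asymp_supernice_def)
    note eq = that[unfolded asymp_supernice_def, THEN conjunct2, THEN conjunct2, THEN bspec]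
    show ?thesis
      unfolding asymp_supernice_wrt_def
      by (intro conjI k, rule bounds[OF k(2)], erule asymp_equiv_sandwich_le, erule eq)
  qed
qed

theorem theorem3:
  fixes h :: "fgraph \<Rightarrow> real" and D :: decomp and k :: int and \<G> :: "nat \<Rightarrow> int \<Rightarrow> fgraph"
  assumes "graph_parameter h" and "is_decomposition D" and "is_selection D \<G>"
  shows
    "(\<forall>P. suitable D \<G> P \<and> has_very_abstract_chromatic_number D \<G> P (Fin k) \<longrightarrow>
        (nice h D k \<G> \<longrightarrow> nice_wrt h D k \<G> P) \<and>
        (supernice h D k \<G> \<longrightarrow> supernice_wrt h D k \<G> P) \<and>
        (asymp_nice h D k \<G> \<longrightarrow> asymp_nice_wrt h D k \<G> P) \<and>
        (asymp_supernice h D k \<G> \<longrightarrow> asymp_supernice_wrt h D k \<G> P))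
     \<and>
     (\<forall>B. is_blowup_decomposition D B \<longrightarrow>
       (\<forall>P. suitable D \<G> P \<and> has_very_abstract_chromatic_number D \<G> P (Fin k) \<longrightarrow>
        (strongly_nice B h D k \<G> \<longrightarrow> strongly_nice_wrt B h D k \<G> P) \<and>
        (strongly_supernice B h D k \<G> \<longrightarrow> strongly_supernice_wrt B h D k \<G> P) \<and>
        (strongly_asymp_nice B h D k \<G> \<longrightarrow> strongly_asymp_nice_wrt B h D k \<G> P) \<and>
        (strongly_asymp_supernice B h D k \<G> \<longrightarrow> strongly_asymp_supernice_wrt B h D k \<G> P)))"
  \<comment> \<open>The strong versions follow at once: \<open>balanced_selection B k \<G>\<close>
    does not involve the partition, so it carries over unchanged.\<close>
  using nice_wrt_suitable_partition[OF assms]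
  by (simp add: strongly_nice_def strongly_nice_wrt_def strongly_supernice_def
      strongly_supernice_wrt_def strongly_asymp_nice_def strongly_asymp_nice_wrt_def
      strongly_asymp_supernice_def strongly_asymp_supernice_wrt_def)

end
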